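(* Let $\mathcal I$ and $\mathcal J$ be ideals on $\mathbb N$ and let $T\colon c_{0,\mathcal I}\to c_{0,\mathcal J}$ be an into Banach lattice isometry. Suppose $T$ has the following properties: (1) for each $n\in\mathbb N$ there is $A\in\mathcal I$ satisfying $T(\chi_A)(n)=1$; (2) for all $\emptyset\neq\mathcal F\subseteq\mathcal I$ such that $\bigcap_{A\in\mathcal F}A=\emptyset$, we have $\bigwedge_{A\in\mathcal F}T(\chi_A)=0$. Then $\mathcal I\leq_K\mathcal J$.
   Context: An ideal on a set $S$ is a collection of subsets of $S$ containing $\emptyset$, closed under taking subsets and under finite unions; it is always assumed to contain every finite subset of $S$ (it need not be proper). $\mathcal I\leq_K\mathcal J$ (Katětov pre-order), for ideals on $\mathbb N$, means that there is $f\colon\mathbb N\to\mathbb N$ with $f^{-1}(A)\in\mathcal J$ for all $A\in\mathcal I$. For an ideal $\mathcal I$ on $\mathbb N$, $c_{0,\mathcal I}$ is the space of all bounded real sequences $(x_n)\in\ell_\infty$ such that $\{n\in\mathbb N: |x_n|\ge\varepsilon\}\in\mathcal I$ for every $\varepsilon>0$, with the sup norm and the pointwise order; it is a Banach lattice. $\chi_A$ is the characteristic function of $A$. An into Banach lattice isometry is a linear isometry $T$, not necessarily onto, with $T(x\wedge y)=Tx\wedge Ty$ for all $x,y$. *)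

theory Defs
  imports "HOL-Analysis.Analysis" "HOL-Library.Lub_Glb"
begin

definition ideal_on :: "'a set \<Rightarrow> 'a set set \<Rightarrow> bool" where
  "ideal_on S \<I> \<longleftrightarrow>
     \<I> \<subseteq> Pow S \<and> {} \<in> \<I> \<and>
     (\<forall>A\<in>\<I>. \<forall>B. B \<subseteq> A \<longrightarrow> B \<in> \<I>) \<and>
     (\<forall>A\<in>\<I>. \<forall>B\<in>\<I>. A \<union> B \<in> \<I>) \<and>
     (\<forall>A. A \<subseteq> S \<longrightarrow> finite A \<longrightarrow> A \<in> \<I>)"

definition katetov_le :: "nat set set \<Rightarrow> nat set set \<Rightarrow> bool" (infix \<open>\<le>\<^sub>K\<close> 50) where
  "\<I> \<le>\<^sub>K \<J> \<longleftrightarrow> (\<exists>f :: nat \<Rightarrow> nat. \<forall>A\<in>\<I>. f -` A \<in> \<J>)"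

text \<open>The Banach lattice \<open>c\<^bsub>0,\<I>\<^esub>\<close> is represented by its carrier, a set of plain
  sequences. The linear structure is pointwise; the order and the lattice operations are the
  pointwise ones of the type \<^typ>\<open>nat \<Rightarrow> real\<close>, under which the carrier is a sublattice.\<close>

definition c0_ideal :: "nat set set \<Rightarrow> (nat \<Rightarrow> real) set" where
  "c0_ideal \<I> = {x. bounded (range x) \<and> (\<forall>\<epsilon>>0. {n. \<bar>x n\<bar> \<ge> \<epsilon>} \<in> \<I>)}"

definition sup_norm :: "(nat \<Rightarrow> real) \<Rightarrow> real" where
  "sup_norm x = (SUP n. \<bar>x n\<bar>)"

text \<open>Nothing is assumed about the values of \<open>T\<close> outside the carrier \<open>X\<close>. The two carriers are
  meant to be sublattices and linear subspaces of the bounded sequences, as \<^const>\<open>c0_ideal\<close>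
  of an ideal is.\<close>

definition into_banach_lattice_isometry ::
  "(nat \<Rightarrow> real) set \<Rightarrow> (nat \<Rightarrow> real) set \<Rightarrow> ((nat \<Rightarrow> real) \<Rightarrow> (nat \<Rightarrow> real)) \<Rightarrow> bool" where
  "into_banach_lattice_isometry X Y T \<longleftrightarrow>
     (\<forall>x\<in>X. T x \<in> Y) \<and>
     (\<forall>x\<in>X. \<forall>y\<in>X. T (\<lambda>n. x n + y n) = (\<lambda>n. T x n + T y n)) \<and>
     (\<forall>c. \<forall>x\<in>X. T (\<lambda>n. c * x n) = (\<lambda>n. c * T x n)) \<and>
     (\<forall>x\<in>X. sup_norm (T x) = sup_norm x) \<and>
     (\<forall>x\<in>X. \<forall>y\<in>X. T (inf x y) = inf (T x) (T y))"

end

theory Submission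
  imports Defs
begin

text \<open>If \<open>T \<chi>\<^sub>B(n) = 1\<close> and \<open>B\<close> is cut into two disjoint pieces, the images of the pieces
  are disjoint and sum to \<open>1\<close> at \<open>n\<close>, so exactly one of them has value \<open>1\<close> there.
  Hence \<open>\<F>\<^sub>n = {A \<in> \<I>. T \<chi>\<^sub>A(n) = 1}\<close> behaves like an ultrafilter. By (1) it is nonempty, and
  by (2) it is fixed: otherwise \<open>\<chi>\<^bsub>{n}\<^esub>\<close> would be a lower bound of the images of its members.
  Picking \<open>f n \<in> \<Inter>\<F>\<^sub>n\<close> gives \<open>f\<^sup>-\<^sup>1(A) \<subseteq> {n. T \<chi>\<^sub>A(n) \<ge> 1} \<in> \<J>\<close>.\<close>

lemma indicator_in_c0_ideal:
  assumes "ideal_on UNIV \<I>" "A \<in> \<I>"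
  shows "(indicator A :: nat \<Rightarrow> real) \<in> c0_ideal \<I>"
proof -
  have "bounded (range (indicator A :: nat \<Rightarrow> real))"
    unfolding bounded_iff by (rule exI[of _ 1]) (auto simp: indicator_def)
  moreover have "{n. \<bar>indicator A n :: real\<bar> \<ge> \<epsilon>} \<in> \<I>" if "\<epsilon> > 0" for \<epsilon>
  proof -
    have "{n. \<bar>indicator A n :: real\<bar> \<ge> \<epsilon>} \<subseteq> A"
      using that by (auto simp: indicator_def split: if_splits)
    then show ?thesis
      using assms unfolding ideal_on_def by blast
  qed
  ultimately show ?thesis
    by (simp add: c0_ideal_def)
qed

text \<open>Homogeneity with scalar 0. As \<open>X\<close> is an arbitrary set, a point
  \<open>x\<close> of it has to be supplied.\<close>

lemma lattice_isometry_zero: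
  assumes "into_banach_lattice_isometry X Y T" "x \<in> X"
  shows "T (\<lambda>n. 0) = (\<lambda>n. 0)"
proof -
  have "T (\<lambda>n. 0 * x n) = (\<lambda>n. 0 * T x n)"
    using assms unfolding into_banach_lattice_isometry_def by blast
  then show ?thesis by simp
qed

lemma lattice_isometry_mono:
  assumes "into_banach_lattice_isometry X Y T" "x \<in> X" "y \<in> X" "x \<le> y"
  shows "T x \<le> T y"
proof -
  have "T (inf x y) = inf (T x) (T y)"
    using assms unfolding into_banach_lattice_isometry_def by blast
  with \<open>x \<le> y\<close> show ?thesis
    by (metis inf.absorb1 inf.cobounded2)
qed

text \<open>The cut is made inside \<open>B\<close> because the full complement of \<open>A\<close>
  may lie outside \<I>, and its indicator outside the domain of \<open>T\<close>.\<close>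

lemma lattice_isometry_indicator_split:
  assumes I: "ideal_on UNIV \<I>"
    and T: "into_banach_lattice_isometry (c0_ideal \<I>) Y T"
    and B: "B \<in> \<I>" and B1: "T (indicator B) n = 1"
  shows "T (indicator (B \<inter> A)) n = 1 \<or> T (indicator (B - A)) n = 1"
proof -
  let ?x = "indicator (B \<inter> A) :: nat \<Rightarrow> real"
  let ?y = "indicator (B - A) :: nat \<Rightarrow> real"
  have x: "?x \<in> c0_ideal \<I>" and y: "?y \<in> c0_ideal \<I>"
    using I B by (auto intro!: indicator_in_c0_ideal simp: ideal_on_def)
  have "(\<lambda>k. ?x k + ?y k) = indicator B" "inf ?x ?y = (\<lambda>k. 0)"
    by (auto simp: fun_eq_iff indicator_def inf_fun_def inf_real_def)
  moreover have "T (\<lambda>k. ?x k + ?y k) = (\<lambda>k. T ?x k + T ?y k)"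
      "T (inf ?x ?y) = inf (T ?x) (T ?y)"
    using T x y unfolding into_banach_lattice_isometry_def by blast+
  \<comment> \<open>Two reals with sum 1 and minimum 0 are 0 and 1 in some order.\<close>
  ultimately have "T ?x n + T ?y n = 1" "inf (T ?x n) (T ?y n) = 0"
    using B1 lattice_isometry_zero[OF T x] by (metis, metis inf_fun_def)
  then show ?thesis
    by (auto simp: inf_real_def min_def split: if_splits)
qed

theorem theorem3p7:
  fixes \<I> \<J> :: "nat set set"
    and T :: "(nat \<Rightarrow> real) \<Rightarrow> (nat \<Rightarrow> real)"
  assumes "ideal_on UNIV \<I>"
    and "ideal_on UNIV \<J>"
    and "into_banach_lattice_isometry (c0_ideal \<I>) (c0_ideal \<J>) T"
    and "\<And>n. \<exists>A\<in>\<I>. T (indicator A) n = 1"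
    and "\<And>\<F>. \<F> \<noteq> {} \<Longrightarrow> \<F> \<subseteq> \<I> \<Longrightarrow> \<Inter>\<F> = {} \<Longrightarrow>
           isGlb (c0_ideal \<J>) ((\<lambda>A. T (indicator A)) ` \<F>) (\<lambda>n. 0)"
  shows "\<I> \<le>\<^sub>K \<J>"
proof -
  note I = assms(1) and J = assms(2) and T = assms(3)
  define F where "F n = {A \<in> \<I>. T (indicator A) n = 1}" for n
  \<comment> \<open>Positivity handles the coordinates other than \<open>n\<close> when
    \<open>indicator {n}\<close> is compared with the images of the members of
    \<open>F n\<close>.\<close>
  have nonneg: "0 \<le> T (indicator A) k" if "A \<in> \<I>" for A k
  proof -
    have "{} \<in> \<I>" using I by (simp add: ideal_on_def)
    then have zero: "(\<lambda>n. 0) \<in> c0_ideal \<I>"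
      using indicator_in_c0_ideal[OF I, of "{}"] by (simp add: indicator_def [abs_def])
    have "T (\<lambda>n. 0) \<le> T (indicator A)"
      using that by (intro lattice_isometry_mono[OF T zero] indicator_in_c0_ideal[OF I])
        (auto simp: le_fun_def)
    then show ?thesis
      by (simp add: lattice_isometry_zero[OF T zero] le_fun_def)
  qed
  have "\<Inter>(F n) \<noteq> {}" for n
  proof
    assume "\<Inter>(F n) = {}"
    moreover have "F n \<noteq> {}" "F n \<subseteq> \<I>"
      using assms(4)[of n] by (auto simp: F_def)
    ultimately have glb: "isGlb (c0_ideal \<J>) ((\<lambda>A. T (indicator A)) ` F n) (\<lambda>n. 0)"
      using assms(5) by blast
    have "isLb (c0_ideal \<J>) ((\<lambda>A. T (indicator A)) ` F n) (indicator {n})"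
      unfolding isLb_def setge_def
    proof (intro conjI ballI)
      show "indicator {n} \<in> c0_ideal \<J>"
        using J by (intro indicator_in_c0_ideal) (auto simp: ideal_on_def)
      show "indicator {n} \<le> g" if "g \<in> (\<lambda>A. T (indicator A)) ` F n" for g
        using that by (auto simp: le_fun_def F_def indicator_def nonneg)
    qed
    \<comment> \<open>The singleton is in \<J>, so \<open>indicator {n}\<close> is a lower bound
      inside the carrier and must lie below the infimum 0, which fails at \<open>n\<close>.\<close>
    then have "(indicator {n} :: nat \<Rightarrow> real) \<le> (\<lambda>n. 0)"
      using glb by (auto simp: isGlb_def greatestP_def setle_def)
    then have "(indicator {n} n :: real) \<le> 0"
      by (rule le_funD)
    then show False by simp
  qed
  then have "\<forall>n. \<exists>k. k \<in> \<Inter>(F n)"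
    by (simp only: ex_in_conv) simp
  then obtain f where f: "\<And>n. f n \<in> \<Inter>(F n)"
    using choice[of "\<lambda>n k. k \<in> \<Inter>(F n)"] by blast
  have "f -` A \<in> \<J>" if A: "A \<in> \<I>" for A
  proof -
    have "1 \<le> T (indicator A) n" if "f n \<in> A" for n
    proof -
      \<comment> \<open>\<open>B\<close> comes from (1) and need not be related to \<open>A\<close>;
        cutting it along \<open>A\<close> decides which piece has value 1 at
        \<open>n\<close>.\<close>
      obtain B where B: "B \<in> \<I>" "T (indicator B) n = 1"
        using assms(4) by blast
      have sub: "B \<inter> A \<in> \<I>" "B - A \<in> \<I>"
        using I B by (auto simp: ideal_on_def)
      \<comment> \<open>Otherwise \<open>B - A\<close> would belong to \<open>F n\<close> and so
        contain \<open>f n\<close>, which lies in \<open>A\<close>.\<close>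
      have "T (indicator (B - A)) n \<noteq> 1"
        using f[of n] sub \<open>f n \<in> A\<close> by (auto simp: F_def)
      then have "1 = T (indicator (B \<inter> A)) n"
        using lattice_isometry_indicator_split[OF I T B] by metis
      also have "\<dots> \<le> T (indicator A) n"
        using sub A by (intro le_funD[OF lattice_isometry_mono[OF T]] indicator_in_c0_ideal[OF I])
          (auto simp: le_fun_def indicator_def)
      finally show ?thesis .
    qed
    \<comment> \<open>The superset is the level set of \<open>T (indicator A)\<close> for \<epsilon>
      = 1.\<close>
    then have "f -` A \<subseteq> {n. 1 \<le> \<bar>T (indicator A) n\<bar>}"
      by force
    moreover have "T (indicator A) \<in> c0_ideal \<J>"
      using T indicator_in_c0_ideal[OF I A] by (simp add: into_banach_lattice_isometry_def)
    then have "{n. 1 \<le> \<bar>T (indicator A) n\<bar>} \<in> \<J>"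
      by (simp add: c0_ideal_def)
    ultimately show ?thesis
      using J unfolding ideal_on_def by blast
  qed
  then show ?thesis
    unfolding katetov_le_def by blast
qed

end
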